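(* For any boolean function $f:\{0,1\}^I\to\{0,1\}$, we have $bs^{\lim}(f)=(bs^* )^{\lim}(f)$.
   Context: For $x\in\{0,1\}^I$ and $B\subseteq I$, $x\oplus B$ is $x$ with the bits in $B$ flipped; a block of $f$ at $x$ is $B\subseteq I$ with $f(x\oplus B)\ne f(x)$. $bs_x(f)$ is the maximum number of pairwise disjoint blocks of $f$ at $x$. $bs^*_x(f)$ is the maximum of $\sum_B\lambda(B)$ over all $\lambda$ assigning nonnegative reals to blocks of $f$ at $x$ with $\sum_{B\ni i}\lambda(B)\le 1$ for every $i\in I$. For $m\in\{bs,bs^*\}$, $m(f)=\max_x m_x(f)$. Composition: for $f$ on $I$ and $g$ on $J$, $f\circ g$ on $I\times J$ is $(f\circ g)(z)=f((g(z_{i,\cdot}))_{i\in I})$, where $z_{i,\cdot}$ is the restriction of $z$ to $\{i\}\times J$; $f^{(1)}=f$, $f^{(k)}=f\circ f^{(k-1)}$; and $m^{\lim}(f)=\liminf_{k\to\infty}m(f^{(k)})^{1/k}$. *)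

theory Defs
  imports "HOL-Analysis.Analysis" "HOL-Library.Disjoint_Sets"
begin

text \<open>
  A point of \<open>{0,1}\<^sup>I\<close> is an extensional function in \<open>I \<rightarrow>\<^sub>E UNIV\<close>.
  A boolean function on \<open>I\<close> is a function \<open>('a \<Rightarrow> bool) \<Rightarrow> bool\<close> of which only the values
  on the cube are ever used.
\<close>

definition cube :: "'a set \<Rightarrow> ('a \<Rightarrow> bool) set" where
  "cube I = I \<rightarrow>\<^sub>E UNIV"

definition flip :: "'a set \<Rightarrow> ('a \<Rightarrow> bool) \<Rightarrow> 'a set \<Rightarrow> ('a \<Rightarrow> bool)" where
  "flip I x B = (\<lambda>i\<in>I. if i \<in> B then \<not> x i else x i)"

definition blocks :: "'a set \<Rightarrow> (('a \<Rightarrow> bool) \<Rightarrow> bool) \<Rightarrow> ('a \<Rightarrow> bool) \<Rightarrow> 'a set set" where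
  "blocks I f x = {B. B \<subseteq> I \<and> f (flip I x B) \<noteq> f x}"

definition bs_at :: "'a set \<Rightarrow> (('a \<Rightarrow> bool) \<Rightarrow> bool) \<Rightarrow> ('a \<Rightarrow> bool) \<Rightarrow> nat" where
  "bs_at I f x = Max {card F | F. F \<subseteq> blocks I f x \<and> disjoint F}"

definition bs :: "'a set \<Rightarrow> (('a \<Rightarrow> bool) \<Rightarrow> bool) \<Rightarrow> nat" where
  "bs I f = Max (bs_at I f ` cube I)"

definition fractional_packing ::
  "'a set \<Rightarrow> (('a \<Rightarrow> bool) \<Rightarrow> bool) \<Rightarrow> ('a \<Rightarrow> bool) \<Rightarrow> ('a set \<Rightarrow> real) \<Rightarrow> bool" where
  "fractional_packing I f x l \<longleftrightarrow>
     (\<forall>B\<in>blocks I f x. 0 \<le> l B) \<and>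
     (\<forall>i\<in>I. (\<Sum>B\<in>{B \<in> blocks I f x. i \<in> B}. l B) \<le> 1)"

text \<open>The supremum is a maximum when \<open>I\<close> is finite; see \<open>fbs_at_attained\<close> below.\<close>

definition fbs_at :: "'a set \<Rightarrow> (('a \<Rightarrow> bool) \<Rightarrow> bool) \<Rightarrow> ('a \<Rightarrow> bool) \<Rightarrow> real" where
  "fbs_at I f x = Sup {(\<Sum>B\<in>blocks I f x. l B) | l. fractional_packing I f x l}"

definition fbs :: "'a set \<Rightarrow> (('a \<Rightarrow> bool) \<Rightarrow> bool) \<Rightarrow> real" where
  "fbs I f = Max (fbs_at I f ` cube I)"

definition bcomp :: "'a set \<Rightarrow> (('a \<Rightarrow> bool) \<Rightarrow> bool) \<Rightarrow> 'b set \<Rightarrow> (('b \<Rightarrow> bool) \<Rightarrow> bool)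
    \<Rightarrow> ('a \<times> 'b \<Rightarrow> bool) \<Rightarrow> bool" where
  "bcomp I f J g z = f (\<lambda>i\<in>I. g (\<lambda>j\<in>J. z (i, j)))"

text \<open>
  The index set \<open>I\<^sup>k\<close> of the \<open>k\<close>-th iterate is represented by the lists of length \<open>k\<close> over \<open>I\<close>,
  so that all iterates share one type; \<open>I \<times> I\<^sup>k\<close> is identified with \<open>I\<^sup>k\<^sup>+\<^sup>1\<close> via
  \<open>(i, w) \<mapsto> i # w\<close>, and \<open>I\<close> with \<open>I\<^sup>1\<close> via \<open>i \<mapsto> [i]\<close>.
\<close>

definition words :: "'a set \<Rightarrow> nat \<Rightarrow> 'a list set" where
  "words I k = {w. length w = k \<and> set w \<subseteq> I}"

text \<open>The iterate for \<open>k = 0\<close> is a dummy; it does not influence the limits below.\<close>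

fun iterate :: "'a set \<Rightarrow> (('a \<Rightarrow> bool) \<Rightarrow> bool) \<Rightarrow> nat \<Rightarrow> ('a list \<Rightarrow> bool) \<Rightarrow> bool" where
  "iterate I f 0 = (\<lambda>z. z [])"
| "iterate I f (Suc 0) = (\<lambda>z. f (\<lambda>i\<in>I. z [i]))"
| "iterate I f (Suc (Suc k)) =
     (\<lambda>z. bcomp I f (words I (Suc k)) (iterate I f (Suc k))
            (\<lambda>(i, w)\<in>I \<times> words I (Suc k). z (i # w)))"

definition bs_lim :: "'a set \<Rightarrow> (('a \<Rightarrow> bool) \<Rightarrow> bool) \<Rightarrow> ereal" where
  "bs_lim I f = liminf (\<lambda>k. ereal (root k (real (bs (words I k) (iterate I f k)))))"

definition fbs_lim :: "'a set \<Rightarrow> (('a \<Rightarrow> bool) \<Rightarrow> bool) \<Rightarrow> ereal" where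
  "fbs_lim I f = liminf (\<lambda>k. ereal (root k (fbs (words I k) (iterate I f k))))"

lemma finite_blocks: "finite I \<Longrightarrow> finite (blocks I f x)"
  unfolding blocks_def by simp

lemma empty_notin_blocks: "x \<in> cube I \<Longrightarrow> {} \<notin> blocks I f x"
proof -
  assume "x \<in> cube I"
  then have "flip I x {} = x"
    by (auto simp: flip_def cube_def PiE_def extensional_restrict)
  then show ?thesis by (simp add: blocks_def)
qed

lemma fractional_packing_le_1:
  assumes "finite I" "x \<in> cube I" "fractional_packing I f x l" "B \<in> blocks I f x"
  shows "l B \<le> 1"
proof -
  obtain i where i: "i \<in> B" using empty_notin_blocks[OF assms(2)] assms(4) by fastforce
  then have "i \<in> I" using assms(4) by (auto simp: blocks_def)
  have "l B \<le> (\<Sum>B\<in>{B \<in> blocks I f x. i \<in> B}. l B)"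
    using assms(3,4) i finite_blocks[OF assms(1)]
    by (intro member_le_sum) (auto simp: fractional_packing_def)
  also have "\<dots> \<le> 1" using assms(3) \<open>i \<in> I\<close> by (auto simp: fractional_packing_def)
  finally show ?thesis .
qed

lemma fbs_at_attained:
  assumes fin: "finite I" and x: "x \<in> cube I"
  shows "\<exists>l. fractional_packing I f x l \<and> fbs_at I f x = (\<Sum>B\<in>blocks I f x. l B) \<and>
             (\<forall>l'. fractional_packing I f x l' \<longrightarrow> (\<Sum>B\<in>blocks I f x. l' B) \<le> (\<Sum>B\<in>blocks I f x. l B))"
proof -
  let ?S = "\<lambda>l. \<Sum>B\<in>blocks I f x. l B"
  define K where "K = PiE UNIV (\<lambda>B. if B \<in> blocks I f x then {0..1::real} else {0})"
  define C where "C = {l. \<forall>i\<in>I. (\<Sum>B\<in>{B \<in> blocks I f x. i \<in> B}. l B) \<le> (1::real)}"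
  have "compactin (product_topology (\<lambda>i. euclidean) UNIV) K"
    unfolding K_def by (subst compactin_PiE) auto
  then have "compact K"
    by (simp add: euclidean_product_topology)
  moreover have "closed C"
  proof -
    have "C = (\<Inter>i\<in>I. {l. (\<Sum>B\<in>{B \<in> blocks I f x. i \<in> B}. l B) \<le> (1::real)})"
      by (auto simp: C_def)
    moreover have "closed \<dots>"
      by (intro closed_INT ballI closed_Collect_le continuous_intros continuous_on_sum) auto
    ultimately show ?thesis by simp
  qed
  ultimately have comp: "compact (K \<inter> C)" by (rule compact_Int_closed)
  have "(\<lambda>_. 0) \<in> K \<inter> C" by (auto simp: K_def C_def)
  moreover have "continuous_on (K \<inter> C) ?S"
    by (intro continuous_on_sum continuous_on_subset[OF continuous_on_product_coordinates]) auto
  ultimately obtain l where l: "l \<in> K \<inter> C" and mx: "\<And>l'. l' \<in> K \<inter> C \<Longrightarrow> ?S l' \<le> ?S l"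
    using continuous_attains_sup[OF comp] by blast
  have pack: "fractional_packing I f x l"
    using l by (fastforce simp: fractional_packing_def K_def C_def PiE_def Pi_def split: if_splits)
  have ub: "?S l' \<le> ?S l" if p: "fractional_packing I f x l'" for l'
  proof -
    let ?m = "\<lambda>B. if B \<in> blocks I f x then l' B else 0"
    have "(\<Sum>B\<in>{B \<in> blocks I f x. i \<in> B}. ?m B) = (\<Sum>B\<in>{B \<in> blocks I f x. i \<in> B}. l' B)" for i
      by (rule sum.cong) auto
    then have "?m \<in> K \<inter> C"
      using p fractional_packing_le_1[OF fin x p]
      by (auto simp: K_def C_def fractional_packing_def)
    from mx[OF this] show ?thesis by (simp cong: sum.cong)
  qed
  have "fbs_at I f x = ?S l"
    unfolding fbs_at_def using pack ub by (intro cSup_eq_maximum) auto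
  with pack ub show ?thesis by blast
qed

end

theory Submission
  imports Defs
begin

text \<open>
  Let \<open>\<beta>\<^sub>k(a)\<close> be the maximum of the block sensitivity of \<open>f\<^sup>(\<^sup>k\<^sup>)\<close> over the inputs with value \<open>a\<close>.
  An integral packing of blocks of \<open>f\<close> at \<open>x\<close> with capacities \<open>\<beta>\<^sub>k(x\<^sub>i)\<close> can be realised by disjoint
  blocks of \<open>f\<^sup>(\<^sup>k\<^sup>+\<^sup>1\<^sup>)\<close>, whereas a fractional packing of blocks of \<open>f\<^sup>(\<^sup>k\<^sup>+\<^sup>1\<^sup>)\<close> projects to a fractional
  packing of blocks of \<open>f\<close> whose capacities are the fractional block sensitivities of the rows.
  Rounding a packing down loses at most \<open>2\<^sup>|\<^sup>I\<^sup>|\<close>, which is negligible for a value \<open>a\<close> with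
  \<open>\<beta>\<^sub>k(a) \<rightarrow> \<infinity>\<close>. For a value \<open>a\<close> with finite \<open>c = liminf \<beta>\<^sub>k(a)\<close> the fractional block sensitivities
  are bounded: at an \<open>x\<close> with \<open>f x = a\<close>, a minimal block consisting of coordinates of limit capacity
  at least \<open>c\<close> is contained in every other block, because otherwise some point of value \<open>a\<close> has two
  disjoint blocks that push the capacity beyond \<open>c\<close>; and if there is no such block, all blocks meet
  the coordinates of smaller limit capacity.
\<close>

section \<open>Cubes, blocks and packings\<close>

lemma flip_in_cube: "flip I x B \<in> cube I"
  by (auto simp: flip_def cube_def)

lemma flip_flip_disjoint:
  assumes "A \<inter> B = {}"
  shows "flip I (flip I x A) B = flip I x (A \<union> B)"
  using assms by (auto simp: flip_def restrict_def fun_eq_iff)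

lemma flip_difference:
  assumes "x \<in> cube I" "y \<in> cube I"
  shows "flip I x {i \<in> I. x i \<noteq> y i} = y"
  using assms by (auto simp: flip_def cube_def fun_eq_iff PiE_def extensional_def restrict_def)

lemma finite_cube: "finite I \<Longrightarrow> finite (cube I)"
  unfolding cube_def by (rule finite_PiE) auto

lemma cube_nonempty: "cube I \<noteq> {}"
  unfolding cube_def by (simp add: PiE_eq_empty_iff)

lemma finite_words: "finite I \<Longrightarrow> finite (words I k)"
  using finite_lists_length_eq[of I k] by (simp add: words_def conj_commute)

section \<open>Integral and fractional packings at a point\<close>

lemma finite_packing_cards: "finite I \<Longrightarrow> finite {card F | F. F \<subseteq> blocks I f x \<and> disjoint F}"
  by (rule finite_subset[of _ "card ` Pow (blocks I f x)"]) (auto simp: finite_blocks)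

lemma card_le_bs_at:
  assumes "finite I" "F \<subseteq> blocks I f x" "disjoint F"
  shows "card F \<le> bs_at I f x"
  unfolding bs_at_def using assms by (intro Max_ge finite_packing_cards) auto

lemma bs_at_attained:
  assumes "finite I"
  obtains F where "F \<subseteq> blocks I f x" "disjoint F" "card F = bs_at I f x"
proof -
  have "bs_at I f x \<in> {card F | F. F \<subseteq> blocks I f x \<and> disjoint F}"
    unfolding bs_at_def
    by (rule Max_in[OF finite_packing_cards[OF assms]]) (auto intro: exI[of _ "{}"])
  then show ?thesis using that by auto
qed

text \<open>Double counting: the right-hand side counts \<open>l B\<close> once for every element of
  \<open>B \<inter> H\<close>, hence at least once.\<close>

lemma sum_le_sum_hitting:
  fixes l :: "'a set \<Rightarrow> real"
  assumes "finite A" "finite H" "\<And>B. B \<in> A \<Longrightarrow> 0 \<le> l B" "\<And>B. B \<in> A \<Longrightarrow> B \<inter> H \<noteq> {}"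
  shows "(\<Sum>B\<in>A. l B) \<le> (\<Sum>i\<in>H. \<Sum>B\<in>{B \<in> A. i \<in> B}. l B)"
proof -
  have "(\<Sum>B\<in>A. l B) \<le> (\<Sum>B\<in>A. \<Sum>i\<in>{i \<in> H. i \<in> B}. l B)"
  proof (rule sum_mono)
    fix B assume B: "B \<in> A"
    then obtain i where "i \<in> B \<inter> H" using assms(4) by blast
    then have "card {i \<in> H. i \<in> B} \<ge> 1"
      using assms(2) by (auto simp: Suc_le_eq card_gt_0_iff)
    then have "1 * l B \<le> real (card {i \<in> H. i \<in> B}) * l B"
      by (intro mult_right_mono assms(3)[OF B]) simp
    then show "l B \<le> (\<Sum>i\<in>{i \<in> H. i \<in> B}. l B)" by simp
  qed
  also have "\<dots> = (\<Sum>i\<in>H. \<Sum>B\<in>{B \<in> A. i \<in> B}. l B)"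
    by (rule sum.swap_restrict[OF assms(1,2)])
  finally show ?thesis .
qed

lemma packing_sum_le_fbs_at:
  assumes "finite I" "x \<in> cube I" "fractional_packing I f x l"
  shows "(\<Sum>B\<in>blocks I f x. l B) \<le> fbs_at I f x"
  using fbs_at_attained[OF assms(1,2), of f] assms(3) by auto

text \<open>The indicator of a largest disjoint family of blocks is a fractional packing, since each
  coordinate lies in at most one member.\<close>

lemma bs_at_le_fbs_at:
  assumes "finite I" "x \<in> cube I"
  shows "real (bs_at I f x) \<le> fbs_at I f x"
proof -
  obtain F where F: "F \<subseteq> blocks I f x" "disjoint F" "card F = bs_at I f x"
    using bs_at_attained[OF assms(1)] .
  have finF: "finite F" using F(1) finite_blocks[OF assms(1)] finite_subset by blast
  let ?l = "\<lambda>B. if B \<in> F then 1 else 0 :: real"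
  have "fractional_packing I f x ?l"
    unfolding fractional_packing_def
  proof (intro conjI ballI)
    fix i assume "i \<in> I"
    have "(\<Sum>B\<in>{B \<in> blocks I f x. i \<in> B}. ?l B) = real (card {B \<in> F. i \<in> B})"
      using F(1) finite_blocks[OF assms(1), of f x]
      by (simp add: sum.If_cases Int_def) (rule arg_cong[where f = card], auto)
    also have "card {B \<in> F. i \<in> B} \<le> 1"
      using F(2) finF by (subst One_nat_def, subst card_le_Suc0_iff_eq) (auto dest: disjointD)
    finally show "(\<Sum>B\<in>{B \<in> blocks I f x. i \<in> B}. ?l B) \<le> 1" by simp
  qed auto
  then have "(\<Sum>B\<in>blocks I f x. ?l B) \<le> fbs_at I f x"
    by (rule packing_sum_le_fbs_at[OF assms])
  moreover have "blocks I f x \<inter> F = F" using F(1) by auto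
  ultimately show ?thesis
    using F(3) finite_blocks[OF assms(1), of f x] by (simp add: sum.If_cases)
qed

lemma fbs_at_le_card:
  assumes "finite I" "x \<in> cube I"
  shows "fbs_at I f x \<le> real (card I)"
proof -
  obtain l where l: "fractional_packing I f x l" "fbs_at I f x = (\<Sum>B\<in>blocks I f x. l B)"
    using fbs_at_attained[OF assms, of f] by auto
  have "(\<Sum>B\<in>blocks I f x. l B) \<le> (\<Sum>i\<in>I. \<Sum>B\<in>{B \<in> blocks I f x. i \<in> B}. l B)"
  proof (rule sum_le_sum_hitting[OF finite_blocks assms(1)])
    fix B assume B: "B \<in> blocks I f x"
    then show "0 \<le> l B" using l(1) by (auto simp: fractional_packing_def)
    show "B \<inter> I \<noteq> {}" using B empty_notin_blocks[OF assms(2), of f]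
      by (auto simp: blocks_def inf_absorb1)
  qed (rule assms)
  also have "\<dots> \<le> (\<Sum>i\<in>I. 1)"
    using l(1) by (intro sum_mono) (auto simp: fractional_packing_def)
  finally show ?thesis using l(2) by simp
qed

lemma bs_le_fbs:
  assumes "finite I"
  shows "real (bs I f) \<le> fbs I f"
proof -
  have "bs I f \<in> bs_at I f ` cube I"
    unfolding bs_def using assms by (intro Max_in) (auto simp: finite_cube cube_nonempty)
  then obtain x where x: "x \<in> cube I" "bs I f = bs_at I f x" by auto
  have "fbs_at I f x \<le> fbs I f"
    unfolding fbs_def using assms x by (intro Max_ge) (auto simp: finite_cube)
  with bs_at_le_fbs_at[OF assms x(1), of f] x(2) show ?thesis by simp
qed

lemma fbs_attained:
  assumes "finite I"
  obtains x where "x \<in> cube I" "fbs I f = fbs_at I f x"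
proof -
  have "fbs I f \<in> fbs_at I f ` cube I"
    unfolding fbs_def using assms by (intro Max_in) (auto simp: finite_cube cube_nonempty)
  then show ?thesis using that by auto
qed

section \<open>Composition\<close>

definition input_row :: "'a set \<Rightarrow> nat \<Rightarrow> ('a list \<Rightarrow> bool) \<Rightarrow> 'a \<Rightarrow> 'a list \<Rightarrow> bool" where
  "input_row I k z i = (\<lambda>w\<in>words I k. z (i # w))"

definition row_values ::
  "'a set \<Rightarrow> (('a \<Rightarrow> bool) \<Rightarrow> bool) \<Rightarrow> nat \<Rightarrow> ('a list \<Rightarrow> bool) \<Rightarrow> 'a \<Rightarrow> bool" where
  "row_values I f k z = (\<lambda>i\<in>I. iterate I f k (input_row I k z i))"

text \<open>All that the outer function sees of \<open>B\<close>: the rows whose inner value changes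
  when \<open>B\<close> is flipped.\<close>

definition flipped_rows ::
  "'a set \<Rightarrow> (('a \<Rightarrow> bool) \<Rightarrow> bool) \<Rightarrow> nat \<Rightarrow> ('a list \<Rightarrow> bool) \<Rightarrow> 'a list set \<Rightarrow> 'a set" where
  "flipped_rows I f k z B =
     {i \<in> I. {w. i # w \<in> B} \<in> blocks (words I k) (iterate I f k) (input_row I k z i)}"

lemma words_0: "words I 0 = {[]}"
  by (auto simp: words_def)

lemma Cons_in_words: "i # w \<in> words I (Suc k) \<longleftrightarrow> i \<in> I \<and> w \<in> words I k"
  by (auto simp: words_def)

text \<open>The dummy iterate for \<open>k = 0\<close> is the identity on one bit, so the recursion
  has the same form for every \<open>k\<close> and inductions can start at 0.\<close>

lemma iterate_Suc: "iterate I f (Suc k) z = f (row_values I f k z)"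
proof (cases k)
  case 0
  then show ?thesis by (simp add: row_values_def input_row_def words_0 cong: restrict_cong)
next
  case (Suc m)
  then show ?thesis
    unfolding row_values_def input_row_def
    by (auto simp: bcomp_def intro!: arg_cong[where f = f] restrict_ext
        arg_cong[where f = "iterate I f (Suc m)"])
qed

lemma input_row_in_cube: "input_row I k z i \<in> cube (words I k)"
  by (auto simp: input_row_def cube_def)

lemma row_values_in_cube: "row_values I f k z \<in> cube I"
  by (auto simp: row_values_def cube_def)

lemma input_row_flip:
  assumes "i \<in> I"
  shows "input_row I k (flip (words I (Suc k)) z B) i = flip (words I k) (input_row I k z i) {w. i # w \<in> B}"
  using assms by (auto simp: input_row_def flip_def fun_eq_iff Cons_in_words)

lemma row_values_flip:
  assumes "B \<subseteq> words I (Suc k)"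
  shows "row_values I f k (flip (words I (Suc k)) z B)
       = flip I (row_values I f k z) (flipped_rows I f k z B)"
proof -
  have "{w. i # w \<in> B} \<subseteq> words I k" for i using assms by (auto simp: Cons_in_words)
  then show ?thesis
    by (auto simp: row_values_def flip_def[of I] flipped_rows_def input_row_flip blocks_def fun_eq_iff)
qed

lemma blocks_iterate_Suc:
  "B \<in> blocks (words I (Suc k)) (iterate I f (Suc k)) z \<longleftrightarrow>
     B \<subseteq> words I (Suc k) \<and> flipped_rows I f k z B \<in> blocks I f (row_values I f k z)"
proof -
  have "flipped_rows I f k z B \<subseteq> I" by (auto simp: flipped_rows_def)
  then show ?thesis by (auto simp: blocks_def iterate_Suc row_values_flip)
qed

text \<open>The weight of a block of \<^term>\<open>f\<close> is the total weight of the blocks of the iterate that flip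
  exactly these rows.\<close>

lemma packing_iterate_Suc:
  assumes fin: "finite I" and z: "z \<in> cube (words I (Suc k))"
    and x: "x = row_values I f k z"
  obtains m where "\<And>A. A \<in> blocks I f x \<Longrightarrow> 0 \<le> m A"
    and "\<And>i. i \<in> I \<Longrightarrow> (\<Sum>A\<in>{A \<in> blocks I f x. i \<in> A}. m A)
               \<le> fbs_at (words I k) (iterate I f k) (input_row I k z i)"
    and "fbs_at (words I (Suc k)) (iterate I f (Suc k)) z = (\<Sum>A\<in>blocks I f x. m A)"
proof -
  let ?W = "blocks (words I (Suc k)) (iterate I f (Suc k)) z"
  let ?S = "flipped_rows I f k z"
  obtain l where l: "fractional_packing (words I (Suc k)) (iterate I f (Suc k)) z l"
    and leq: "fbs_at (words I (Suc k)) (iterate I f (Suc k)) z = (\<Sum>B\<in>?W. l B)"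
    using fbs_at_attained[OF finite_words[OF fin] z, of "iterate I f (Suc k)"] by auto
  have l0: "0 \<le> l B" if "B \<in> ?W" for B
    using l that by (auto simp: fractional_packing_def)
  have finW: "finite ?W" by (intro finite_blocks finite_words fin)
  have finX: "finite (blocks I f x)" by (rule finite_blocks[OF fin])
  define m where "m A = (\<Sum>B\<in>{B \<in> ?W. ?S B = A}. l B)" for A
  show ?thesis
  proof
    show "0 \<le> m A" for A
      unfolding m_def by (rule sum_nonneg) (auto intro: l0)
    have "(\<Sum>A\<in>blocks I f x. m A) = (\<Sum>B\<in>?W. l B)"
      unfolding m_def
      by (rule sum.group[OF finW finX]) (auto simp: x blocks_iterate_Suc)
    then show "fbs_at (words I (Suc k)) (iterate I f (Suc k)) z = (\<Sum>A\<in>blocks I f x. m A)"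
      using leq by simp
  next
    fix i assume i: "i \<in> I"
    let ?R = "blocks (words I k) (iterate I f k) (input_row I k z i)"
    let ?s = "\<lambda>B. {w. i # w \<in> B}"
    \<comment> \<open>\<open>n\<close> moves the weight of the blocks that flip row \<open>i\<close>
      onto their sections in that row.\<close>
    define n where "n D = (\<Sum>B\<in>{B \<in> {B \<in> ?W. i \<in> ?S B}. ?s B = D}. l B)" for D
    have "(\<Sum>A\<in>{A \<in> blocks I f x. i \<in> A}. m A)
        = (\<Sum>A\<in>{A \<in> blocks I f x. i \<in> A}. \<Sum>B\<in>{B \<in> {B \<in> ?W. i \<in> ?S B}. ?S B = A}. l B)"
      unfolding m_def by (intro sum.cong) auto
    also have "\<dots> = (\<Sum>B\<in>{B \<in> ?W. i \<in> ?S B}. l B)"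
    proof (rule sum.group)
      show "finite {B \<in> ?W. i \<in> ?S B}" "finite {A \<in> blocks I f x. i \<in> A}"
        using finW finX by simp_all
      show "?S ` {B \<in> ?W. i \<in> ?S B} \<subseteq> {A \<in> blocks I f x. i \<in> A}"
        by (auto simp: x blocks_iterate_Suc)
    qed
    also have "\<dots> = (\<Sum>D\<in>?R. n D)"
      unfolding n_def
      by (rule sum.group[symmetric])
        (auto simp: finW flipped_rows_def intro!: finite_blocks finite_words fin)
    also have "\<dots> \<le> fbs_at (words I k) (iterate I f k) (input_row I k z i)"
    proof (rule packing_sum_le_fbs_at[OF finite_words[OF fin] input_row_in_cube])
      show "fractional_packing (words I k) (iterate I f k) (input_row I k z i) n"
        unfolding fractional_packing_def
      proof (intro conjI ballI)
        show "0 \<le> n D" for D unfolding n_def by (rule sum_nonneg) (auto intro: l0)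
      next
        fix w assume w: "w \<in> words I k"
        have "(\<Sum>D\<in>{D \<in> ?R. w \<in> D}. n D)
            = (\<Sum>D\<in>{D \<in> ?R. w \<in> D}. \<Sum>B\<in>{B \<in> {B \<in> ?W. i \<in> ?S B \<and> i # w \<in> B}. ?s B = D}. l B)"
          unfolding n_def by (intro sum.cong) auto
        also have "\<dots> = (\<Sum>B\<in>{B \<in> ?W. i \<in> ?S B \<and> i # w \<in> B}. l B)"
          by (rule sum.group)
            (auto simp: finW flipped_rows_def intro!: finite_subset[OF _ finite_blocks] finite_words fin)
        \<comment> \<open>The additional blocks contain \<open>i # w\<close> but leave the value of
          row \<open>i\<close> unchanged.\<close>
        also have "\<dots> \<le> (\<Sum>B\<in>{B \<in> ?W. i # w \<in> B}. l B)"
          using finW by (intro sum_mono2) (auto intro: l0)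
        also have "\<dots> \<le> 1"
          using l w i by (auto simp: fractional_packing_def Cons_in_words)
        finally show "(\<Sum>D\<in>{D \<in> ?R. w \<in> D}. n D) \<le> 1" .
      qed
    qed
    finally show "(\<Sum>A\<in>{A \<in> blocks I f x. i \<in> A}. m A)
        \<le> fbs_at (words I k) (iterate I f k) (input_row I k z i)" .
  qed
qed

lemma rows_assemble:
  assumes x: "x \<in> cube I"
    and zs: "\<And>i. i \<in> I \<Longrightarrow> zs i \<in> cube (words I k)"
      "\<And>i. i \<in> I \<Longrightarrow> iterate I f k (zs i) = x i"
  obtains z where "z \<in> cube (words I (Suc k))" "\<And>i. i \<in> I \<Longrightarrow> input_row I k z i = zs i"
    "row_values I f k z = x"
proof
  let ?z = "\<lambda>v\<in>words I (Suc k). zs (hd v) (tl v)"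
  show "?z \<in> cube (words I (Suc k))" by (auto simp: cube_def)
  show row: "input_row I k ?z i = zs i" if "i \<in> I" for i
    using zs(1)[OF that] that
    by (auto simp: input_row_def fun_eq_iff Cons_in_words cube_def PiE_def extensional_def restrict_def)
  show "row_values I f k ?z = x"
    using x by (intro extensionalityI[of _ I]) (auto simp: row_values_def row zs(2) cube_def PiE_def)
qed

text \<open>An integral counterpart to \<open>packing_iterate_Suc\<close>, in the opposite
  direction. Take \<open>m A\<close> copies of each block \<open>A\<close>; every copy receives, in
  each row of \<open>A\<close>, its own member of a largest disjoint family of blocks of that row.
  The capacities say that no row runs out.\<close>

lemma disjoint_blocks_iterate_Suc:
  assumes fin: "finite I" and z: "z \<in> cube (words I (Suc k))"
    and x: "row_values I f k z = x"
    and cap: "\<And>i. i \<in> I \<Longrightarrow> (\<Sum>A\<in>{A \<in> blocks I f x. i \<in> A}. m A)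
              \<le> bs_at (words I k) (iterate I f k) (input_row I k z i)"
  shows "(\<Sum>A\<in>blocks I f x. m A) \<le> bs_at (words I (Suc k)) (iterate I f (Suc k)) z"
proof -
  let ?R = "\<lambda>i. blocks (words I k) (iterate I f k) (input_row I k z i)"
  \<comment> \<open>The copies: pairs of a block \<open>A\<close> and a number below
    \<open>m A\<close>.\<close>
  define T where "T = (SIGMA A:blocks I f x. {..<m A})"
  have finX: "finite (blocks I f x)" by (rule finite_blocks[OF fin])
  have finT: "finite T" unfolding T_def using finX by auto
  have ex: "\<exists>e. e ` {t \<in> T. i \<in> fst t} \<subseteq> ?R i \<and> inj_on e {t \<in> T. i \<in> fst t} \<and>
      disjoint (e ` {t \<in> T. i \<in> fst t})" if i: "i \<in> I" for i
  proof -
    obtain F where F: "F \<subseteq> ?R i" "disjoint F"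
      "card F = bs_at (words I k) (iterate I f k) (input_row I k z i)"
      using bs_at_attained[OF finite_words[OF fin]] by metis
    have finF: "finite F" using F(1) finite_blocks[OF finite_words[OF fin]] finite_subset by blast
    have "{t \<in> T. i \<in> fst t} = (SIGMA A:{A \<in> blocks I f x. i \<in> A}. {..<m A})"
      unfolding T_def by auto
    then have "card {t \<in> T. i \<in> fst t} = (\<Sum>A\<in>{A \<in> blocks I f x. i \<in> A}. m A)"
      using finX by simp
    then have "card {t \<in> T. i \<in> fst t} \<le> card F" using cap[OF i] F(3) by simp
    then obtain e where e: "e ` {t \<in> T. i \<in> fst t} \<subseteq> F" "inj_on e {t \<in> T. i \<in> fst t}"
      using card_le_inj[of "{t \<in> T. i \<in> fst t}" F] finT finF by auto
    then have "disjoint (e ` {t \<in> T. i \<in> fst t})"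
      using F(2) by (meson pairwise_subset)
    with e F(1) show ?thesis by blast
  qed
  from bchoice[OF ballI, OF ex] obtain e where
    "\<forall>i\<in>I. e i ` {t \<in> T. i \<in> fst t} \<subseteq> ?R i \<and> inj_on (e i) {t \<in> T. i \<in> fst t} \<and>
      disjoint (e i ` {t \<in> T. i \<in> fst t})" ..
  then have e: "\<And>i t. i \<in> I \<Longrightarrow> t \<in> T \<Longrightarrow> i \<in> fst t \<Longrightarrow> e i t \<in> ?R i"
    "\<And>i. i \<in> I \<Longrightarrow> inj_on (e i) {t \<in> T. i \<in> fst t}"
    "\<And>i. i \<in> I \<Longrightarrow> disjoint (e i ` {t \<in> T. i \<in> fst t})"
    by blast+
  \<comment> \<open>The copy \<open>t\<close> is realised by gluing the blocks assigned to it in the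
    rows of \<open>fst t\<close>.\<close>
  define b where "b t = {i # w | i w. i \<in> fst t \<and> w \<in> e i t}" for t
  have TI: "fst t \<subseteq> I" if "t \<in> T" for t
    using that by (auto simp: T_def blocks_def)
  have blk: "b t \<in> blocks (words I (Suc k)) (iterate I f (Suc k)) z" if t: "t \<in> T" for t
  proof -
    have "b t \<subseteq> words I (Suc k)"
    proof
      fix v assume "v \<in> b t"
      then obtain i w where "v = i # w" "i \<in> fst t" "w \<in> e i t" by (auto simp: b_def)
      then show "v \<in> words I (Suc k)"
        using TI[OF t] e(1)[OF _ t, of i] by (auto simp: Cons_in_words blocks_def)
    qed
    moreover have "flipped_rows I f k z (b t) = fst t"
    proof -
      \<comment> \<open>In a row outside \<open>fst t\<close> the section is empty, and the empty
        set is never a block.\<close>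
      have "{w. i # w \<in> b t} = (if i \<in> fst t then e i t else {})" for i
        by (auto simp: b_def)
      then show ?thesis
        using TI[OF t] e(1)[OF _ t]
        by (auto simp: flipped_rows_def empty_notin_blocks[OF input_row_in_cube] split: if_splits)
    qed
    moreover have "fst t \<in> blocks I f x" using t by (auto simp: T_def)
    ultimately show ?thesis by (simp add: blocks_iterate_Suc x)
  qed
  have disj: "b t \<inter> b t' = {}" if t: "t \<in> T" "t' \<in> T" "t \<noteq> t'" for t t'
  proof (rule ccontr)
    assume "b t \<inter> b t' \<noteq> {}"
    then obtain i w where iw: "i \<in> fst t" "i \<in> fst t'" "w \<in> e i t" "w \<in> e i t'"
      by (auto simp: b_def)
    have i: "i \<in> I" using TI[OF t(1)] iw(1) by auto
    have "e i t \<noteq> e i t'" using e(2)[OF i] t iw by (auto dest: inj_onD)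
    moreover have "e i t \<in> e i ` {t \<in> T. i \<in> fst t}" "e i t' \<in> e i ` {t \<in> T. i \<in> fst t}"
      using t iw by auto
    ultimately have "e i t \<inter> e i t' = {}" using e(3)[OF i] by (meson disjointD)
    with iw show False by auto
  qed
  have ne: "b t \<noteq> {}" if "t \<in> T" for t
    using blk[OF that] empty_notin_blocks[OF z] by metis
  have inj: "inj_on b T" by (rule inj_onI) (metis disj ne inf.idem)
  have "disjoint (b ` T)" by (rule disjointI) (metis disj imageE)
  then have "card (b ` T) \<le> bs_at (words I (Suc k)) (iterate I f (Suc k)) z"
    using blk by (intro card_le_bs_at finite_words fin) auto
  moreover have "card (b ` T) = (\<Sum>A\<in>blocks I f x. m A)"
    using inj finX by (simp add: card_image T_def)
  ultimately show ?thesis by simp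
qed

section \<open>Nonconstant functions\<close>

text \<open>The variable \<open>a\<close> in \<open>attains\<close> is implicitly universally
  quantified: both values are attained.\<close>

locale nonconstant_boolean_function =
  fixes I :: "'a set" and f :: "('a \<Rightarrow> bool) \<Rightarrow> bool"
  assumes finite_I: "finite I" and attains: "\<exists>x\<in>cube I. f x = a"
begin

section \<open>Block sensitivity separated by output value\<close>

definition value_bs :: "nat \<Rightarrow> bool \<Rightarrow> nat" where
  "value_bs k a =
     Max (bs_at (words I k) (iterate I f k) ` {z \<in> cube (words I k). iterate I f k z = a})"

text \<open>The limit capacity of a row of value \<open>a\<close>. Taken in \<open>enat\<close>,
  since it may be infinite.\<close>

definition value_liminf :: "bool \<Rightarrow> enat" where
  "value_liminf a = liminf (\<lambda>k. enat (value_bs k a))"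

lemmas fin_words = finite_words[OF finite_I]

lemma iterate_attains: "\<exists>z\<in>cube (words I k). iterate I f k z = a"
proof (induction k arbitrary: a)
  case 0
  show ?case by (rule bexI[of _ "\<lambda>w\<in>words I 0. a"]) (auto simp: cube_def words_0)
next
  case (Suc k)
  obtain x where x: "x \<in> cube I" "f x = a" using attains by auto
  from Suc.IH obtain zv where zv: "\<And>a. zv a \<in> cube (words I k)" "\<And>a. iterate I f k (zv a) = a"
    by metis
  obtain z where "z \<in> cube (words I (Suc k))" "row_values I f k z = x"
    by (rule rows_assemble[OF x(1), of "\<lambda>i. zv (x i)" k f]) (auto simp: zv)
  then show ?case using x(2) by (auto simp: iterate_Suc)
qed

lemma bs_at_le_value_bs:
  assumes "z \<in> cube (words I k)" "iterate I f k z = a"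
  shows "bs_at (words I k) (iterate I f k) z \<le> value_bs k a"
  unfolding value_bs_def using assms by (intro Max_ge) (auto simp: finite_cube fin_words)

lemma value_bs_attained:
  obtains z where "z \<in> cube (words I k)" "iterate I f k z = a"
    "bs_at (words I k) (iterate I f k) z = value_bs k a"
proof -
  have "value_bs k a \<in>
      bs_at (words I k) (iterate I f k) ` {z \<in> cube (words I k). iterate I f k z = a}"
    unfolding value_bs_def
    using iterate_attains by (intro Max_in) (auto simp: finite_cube fin_words)
  then show ?thesis using that by auto
qed

lemma value_bs_le_bs: "value_bs k a \<le> bs (words I k) (iterate I f k)"
proof -
  obtain z where z: "z \<in> cube (words I k)" "bs_at (words I k) (iterate I f k) z = value_bs k a"
    using value_bs_attained by metis
  then have "value_bs k a \<in> bs_at (words I k) (iterate I f k) ` cube (words I k)" by force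
  then show ?thesis
    unfolding bs_def by (intro Max_ge) (auto simp: finite_cube fin_words)
qed

text \<open>The coordinates in which an input differs from one of the opposite value form a
  block.\<close>

lemma value_bs_ge_1: "1 \<le> value_bs k a"
proof -
  obtain z where z: "z \<in> cube (words I k)" "iterate I f k z = a" using iterate_attains by blast
  obtain y where y: "y \<in> cube (words I k)" "iterate I f k y = (\<not> a)" using iterate_attains by blast
  let ?B = "{w \<in> words I k. z w \<noteq> y w}"
  have "?B \<in> blocks (words I k) (iterate I f k) z"
    using flip_difference[OF z(1) y(1)] z(2) y(2) by (auto simp: blocks_def)
  then have "card {?B} \<le> bs_at (words I k) (iterate I f k) z"
    by (intro card_le_bs_at fin_words) (auto simp: pairwise_def)
  with bs_at_le_value_bs[OF z] show ?thesis by simp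
qed

text \<open>Filling row \<open>i\<close> with an optimal input of value \<open>x i\<close> gives
  this row the capacity \<open>value_bs k (x i)\<close>.\<close>

lemma value_bs_Suc_ge:
  assumes x: "x \<in> cube I"
    and cap: "\<And>i. i \<in> I \<Longrightarrow> (\<Sum>A\<in>{A \<in> blocks I f x. i \<in> A}. m A) \<le> value_bs k (x i)"
  shows "(\<Sum>A\<in>blocks I f x. m A) \<le> value_bs (Suc k) (f x)"
proof -
  have "\<exists>z. z \<in> cube (words I k) \<and> iterate I f k z = a \<and>
      bs_at (words I k) (iterate I f k) z = value_bs k a" for a
    by (rule value_bs_attained[of k a]) blast
  then obtain zv where zv: "\<And>a. zv a \<in> cube (words I k)" "\<And>a. iterate I f k (zv a) = a"
    "\<And>a. bs_at (words I k) (iterate I f k) (zv a) = value_bs k a"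
    by metis
  obtain z where z: "z \<in> cube (words I (Suc k))"
    "\<And>i. i \<in> I \<Longrightarrow> input_row I k z i = zv (x i)" "row_values I f k z = x"
    by (rule rows_assemble[OF x, of "\<lambda>i. zv (x i)" k f]) (auto simp: zv)
  have "(\<Sum>A\<in>blocks I f x. m A) \<le> bs_at (words I (Suc k)) (iterate I f (Suc k)) z"
    by (rule disjoint_blocks_iterate_Suc[OF finite_I z(1,3)]) (use cap in \<open>simp add: z(2) zv(3)\<close>)
  also have "\<dots> \<le> value_bs (Suc k) (f x)"
    by (rule bs_at_le_value_bs[OF z(1)]) (simp add: iterate_Suc z(3))
  finally show ?thesis .
qed

section \<open>Limit capacities\<close>

lemma eventually_value_bs_ge:
  assumes "enat c \<le> value_liminf a"
  shows "eventually (\<lambda>k. c \<le> value_bs k a) sequentially"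
proof (cases c)
  case (Suc d)
  \<comment> \<open>The liminf is characterised by strict lower bounds, so \<open>c\<close> enters
    through its predecessor.\<close>
  have "enat d < enat c" using Suc by simp
  then have "eventually (\<lambda>k. enat d < enat (value_bs k a)) sequentially"
    using assms unfolding value_liminf_def le_Liminf_iff by blast
  then show ?thesis using Suc by (simp add: Suc_le_eq)
qed simp

lemma value_liminf_ge:
  assumes "eventually (\<lambda>k. c \<le> value_bs (Suc k) a) sequentially"
  shows "enat c \<le> value_liminf a"
proof -
  have "eventually (\<lambda>k. c \<le> value_bs k a) sequentially"
    using assms by (rule eventually_sequentially_Suc[THEN iffD1])
  then show ?thesis
    unfolding value_liminf_def le_Liminf_iff
    by (auto elim!: eventually_mono intro: less_le_trans)
qed

text \<open>Limit form of \<open>value_bs_Suc_ge\<close>: there are finitely many rows, so all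
  capacity constraints hold simultaneously for large \<open>k\<close>.\<close>

lemma value_liminf_packing:
  assumes x: "x \<in> cube I"
    and cap: "\<And>i. i \<in> I \<Longrightarrow> enat (\<Sum>A\<in>{A \<in> blocks I f x. i \<in> A}. m A) \<le> value_liminf (x i)"
  shows "enat (\<Sum>A\<in>blocks I f x. m A) \<le> value_liminf (f x)"
proof (rule value_liminf_ge)
  have "eventually (\<lambda>k. \<forall>i\<in>I. (\<Sum>A\<in>{A \<in> blocks I f x. i \<in> A}. m A) \<le> value_bs k (x i)) sequentially"
    by (intro eventually_ball_finite finite_I ballI eventually_value_bs_ge cap)
  then show "eventually (\<lambda>k. (\<Sum>A\<in>blocks I f x. m A) \<le> value_bs (Suc k) (f x)) sequentially"
    by (rule eventually_mono) (auto intro: value_bs_Suc_ge[OF x])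
qed

lemma value_liminf_ge_1: "1 \<le> value_liminf a"
  using value_liminf_ge[of 1 a] value_bs_ge_1 by (simp add: one_enat_def)

text \<open>Pack \<open>c\<close> copies of \<open>B\<close>.\<close>

lemma value_liminf_block:
  assumes x: "x \<in> cube I" and B: "B \<in> blocks I f x" and c: "\<And>i. i \<in> B \<Longrightarrow> enat c \<le> value_liminf (x i)"
  shows "enat c \<le> value_liminf (f x)"
proof -
  let ?m = "\<lambda>A. if A = B then c else 0"
  have finX: "finite (blocks I f x)" by (rule finite_blocks[OF finite_I])
  have "enat (\<Sum>A\<in>blocks I f x. ?m A) \<le> value_liminf (f x)"
    by (rule value_liminf_packing[OF x]) (use finX c in \<open>auto simp: zero_enat_def[symmetric]\<close>)
  then show ?thesis using finX B by simp
qed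

text \<open>Pack \<open>c\<close> copies of \<open>B\<close> and one of \<open>B'\<close>. The
  single copy always fits, because every limit capacity is at least 1. This contradicts a limit
  capacity of exactly \<open>c\<close>.\<close>

lemma value_liminf_two_blocks:
  assumes x: "x \<in> cube I" and B: "B \<in> blocks I f x" "B' \<in> blocks I f x" "B \<inter> B' = {}"
    and c: "\<And>i. i \<in> B \<Longrightarrow> enat c \<le> value_liminf (x i)"
  shows "enat (c + 1) \<le> value_liminf (f x)"
proof -
  let ?m = "\<lambda>A. (if A = B then c else 0) + (if A = B' then 1 else 0)"
  have finX: "finite (blocks I f x)" by (rule finite_blocks[OF finite_I])
  have "enat (\<Sum>A\<in>blocks I f x. ?m A) \<le> value_liminf (f x)"
  proof (rule value_liminf_packing[OF x])
    fix i assume "i \<in> I"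
    have "(\<Sum>A\<in>{A \<in> blocks I f x. i \<in> A}. ?m A)
        = (if i \<in> B then c else 0) + (if i \<in> B' then 1 else 0)"
      using finX B by (simp add: sum.distrib)
    then show "enat (\<Sum>A\<in>{A \<in> blocks I f x. i \<in> A}. ?m A) \<le> value_liminf (x i)"
      using c[of i] B(3) value_liminf_ge_1[of "x i"]
      by (cases "i \<in> B"; cases "i \<in> B'") (auto simp: zero_enat_def[symmetric] one_enat_def)
  qed
  moreover have "(\<Sum>A\<in>blocks I f x. ?m A) = c + 1"
    using finX B by (simp add: sum.distrib)
  ultimately show ?thesis by simp
qed

text \<open>If a block \<open>B'\<close> does not contain \<open>B\<close>, then flipping \<open>B \<inter> B'\<close> either yields a smaller block,
  or leads to a point at which \<open>B - B'\<close> and \<open>B' - B\<close> are disjoint blocks.\<close>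

lemma minimal_block_least:
  assumes x: "x \<in> cube I" and c: "value_liminf (f x) = enat c"
    and B: "B \<in> blocks I f x" "\<And>i. i \<in> B \<Longrightarrow> enat c \<le> value_liminf (x i)"
    and minimal: "\<And>A. A \<in> blocks I f x \<Longrightarrow> A \<subseteq> B \<Longrightarrow> A = B"
    and B': "B' \<in> blocks I f x"
  shows "B \<subseteq> B'"
proof (cases "B \<inter> B' \<in> blocks I f x")
  case True
  with minimal show ?thesis by blast
next
  case False
  define y where "y = flip I x (B \<inter> B')"
  have y: "y \<in> cube I" by (simp add: y_def flip_in_cube)
  have BI: "B \<subseteq> I" "B' \<subseteq> I" using B(1) B' by (auto simp: blocks_def)
  have fy: "f y = f x" using False BI by (auto simp: blocks_def y_def)
  have "flip I y (B - B') = flip I x B" "flip I y (B' - B) = flip I x B'"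
    unfolding y_def by (subst flip_flip_disjoint; (rule arg_cong[where f = "flip I x"])?; blast)+
  then have "B - B' \<in> blocks I f y" "B' - B \<in> blocks I f y"
    using B(1) B' fy by (auto simp: blocks_def)
  \<comment> \<open>Outside \<open>B \<inter> B'\<close> the points \<open>x\<close> and
    \<open>y\<close> agree.\<close>
  moreover have "enat c \<le> value_liminf (y i)" if "i \<in> B - B'" for i
    using B(2)[of i] that BI by (auto simp: y_def flip_def)
  ultimately have "enat (c + 1) \<le> value_liminf (f y)"
    by (intro value_liminf_two_blocks[OF y, of "B - B'" "B' - B"]) auto
  then show ?thesis using fy c by simp
qed

section \<open>Values of finite limit capacity\<close>

text \<open>The bound has two levels so that it does not grow in the induction: a value whose limit
  capacity is not the larger one keeps the bound 1, and the other value inherits at most 1 from each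
  of at most \<open>card I\<close> rows.\<close>

lemma fbs_at_bounded:
  assumes "value_liminf a \<noteq> \<infinity>" "z \<in> cube (words I k)" "iterate I f k z = a"
  shows "fbs_at (words I k) (iterate I f k) z
       \<le> (if value_liminf a \<le> value_liminf (\<not> a) then 1 else max 1 (real (card I)))"
  using assms
proof (induction k arbitrary: a z)
  case 0
  have "fbs_at (words I 0) (iterate I f 0) z \<le> 1"
    using fbs_at_le_card[OF fin_words 0(2), of "iterate I f 0"] by (simp add: words_0)
  then show ?case by auto
next
  case (Suc k)
  let ?L = value_liminf
  let ?b = "\<lambda>a. if ?L a \<le> ?L (\<not> a) then 1 else max 1 (real (card I))"
  let ?fbs = "fbs_at (words I (Suc k)) (iterate I f (Suc k)) z"
  define x where "x = row_values I f k z"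
  have x: "x \<in> cube I" by (simp add: x_def row_values_in_cube)
  have fx: "f x = a" using Suc.prems(3) by (simp add: x_def iterate_Suc)
  have finX: "finite (blocks I f x)" by (rule finite_blocks[OF finite_I])
  obtain c where c: "?L a = enat c" using Suc.prems(1) by (cases "?L a") auto
  obtain m where m0: "\<And>A. A \<in> blocks I f x \<Longrightarrow> 0 \<le> m A"
    and m: "\<And>i. i \<in> I \<Longrightarrow> (\<Sum>A\<in>{A \<in> blocks I f x. i \<in> A}. m A)
               \<le> fbs_at (words I k) (iterate I f k) (input_row I k z i)"
    and meq: "?fbs = (\<Sum>A\<in>blocks I f x. m A)"
    using packing_iterate_Suc[OF finite_I Suc.prems(2) x_def] by metis
  have cap: "(\<Sum>A\<in>{A \<in> blocks I f x. i \<in> A}. m A) \<le> ?b (x i)" if i: "i \<in> I" "?L (x i) \<noteq> \<infinity>" for i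
  proof -
    have "iterate I f k (input_row I k z i) = x i" using i(1) by (simp add: x_def row_values_def)
    from Suc.IH[OF i(2) input_row_in_cube this] m[OF i(1)] show ?thesis by linarith
  qed
  show ?case
  \<comment> \<open>Either some block uses only rows of limit capacity at least that of
    \<open>a\<close>, or every block meets a row of strictly smaller limit capacity.\<close>
  proof (cases "\<exists>B\<in>blocks I f x. \<forall>i\<in>B. ?L a \<le> ?L (x i)")
    case True
    let ?G = "{B \<in> blocks I f x. \<forall>i\<in>B. ?L a \<le> ?L (x i)}"
    have "finite ?G" "?G \<noteq> {}" using finX True by auto
    from finite_has_minimal[OF this]
    obtain B where B: "B \<in> ?G" and "\<forall>A\<in>?G. A \<subseteq> B \<longrightarrow> B = A" ..
    then have Bmin: "A = B" if "A \<in> ?G" "A \<subseteq> B" for A using that by blast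
    have least: "B \<subseteq> B'" if "B' \<in> blocks I f x" for B'
    proof (rule minimal_block_least[OF x _ _ _ _ that])
      show "?L (f x) = enat c" using fx c by simp
      show "B \<in> blocks I f x" using B by simp
      show "enat c \<le> ?L (x i)" if "i \<in> B" for i using B that c by auto
      \<comment> \<open>Subsets of \<open>B\<close> inherit the capacity condition, so minimality in
        \<open>?G\<close> is minimality among all blocks.\<close>
      show "A = B" if "A \<in> blocks I f x" "A \<subseteq> B" for A using Bmin[of A] B that by blast
    qed
    \<comment> \<open>Otherwise \<open>c + 1\<close> copies of \<open>B\<close> could be packed,
      against \<open>?L a = enat c\<close>.\<close>
    have "\<exists>i\<in>B. ?L (x i) \<le> ?L a"
    proof (rule ccontr)
      assume "\<not> (\<exists>i\<in>B. ?L (x i) \<le> ?L a)"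
      then have "enat (Suc c) \<le> ?L (x i)" if "i \<in> B" for i
        using c that by (metis Suc_ile_eq linorder_not_le)
      from value_liminf_block[OF x _ this] B fx c show False by auto
    qed
    then obtain i where i: "i \<in> B" "?L (x i) \<le> ?L a" by blast
    have iI: "i \<in> I" using B i(1) by (auto simp: blocks_def)
    have "?L (x i) \<noteq> \<infinity>" using i(2) c by (cases "?L (x i)") auto
    from cap[OF iI this] have "(\<Sum>A\<in>{A \<in> blocks I f x. i \<in> A}. m A) \<le> ?b (x i)" .
    \<comment> \<open>Every block passes through row \<open>i\<close>, so this row alone bounds the
      whole packing.\<close>
    moreover have "{A \<in> blocks I f x. i \<in> A} = blocks I f x" using least i(1) by auto
    moreover have "?b (x i) \<le> ?b a"
      using i(2) by (cases "x i = a") (auto simp: not_le)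
    ultimately show ?thesis using meq by simp
  next
    case False
    let ?H = "{i \<in> I. ?L (x i) < ?L a}"
    have finH: "finite ?H" using finite_I by simp
    have hit: "A \<inter> ?H \<noteq> {}" if A: "A \<in> blocks I f x" for A
    proof -
      obtain i where "i \<in> A" "\<not> ?L a \<le> ?L (x i)" using False A by blast
      then show ?thesis using A by (auto simp: blocks_def)
    qed
    have le: "?fbs \<le> (\<Sum>i\<in>?H. \<Sum>A\<in>{A \<in> blocks I f x. i \<in> A}. m A)"
      unfolding meq by (rule sum_le_sum_hitting[OF finX finH m0 hit])
    also have "\<dots> \<le> (\<Sum>i\<in>?H. 1)"
    proof (rule sum_mono)
      fix i assume i: "i \<in> ?H"
      then have "?L (x i) \<noteq> \<infinity>" by (cases "?L (x i)") auto
      \<comment> \<open>A row in \<open>?H\<close> has a limit capacity different from that of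
        \<open>a\<close>, hence the opposite value; being the smaller one, it has bound 1.\<close>
      moreover have "a = (\<not> x i)" using i by (cases a; cases "x i") auto
      then have "?b (x i) = 1" using i by auto
      ultimately show "(\<Sum>A\<in>{A \<in> blocks I f x. i \<in> A}. m A) \<le> 1"
        using cap[of i] i by simp
    qed
    finally have card: "?fbs \<le> real (card ?H)" by simp
    show ?thesis
    proof (cases "?H = {}")
      case True
      then have "?fbs \<le> 0" using card by (simp only: card.empty of_nat_0)
      then show ?thesis by auto
    next
      case False
      then obtain i where i: "?L (x i) < ?L a" by auto
      then have "x i = (\<not> a)" by (cases a; cases "x i") auto
      then have "?b a = max 1 (real (card I))" using i by auto
      moreover have "card ?H \<le> card I" by (rule card_mono[OF finite_I]) auto
      ultimately show ?thesis using card by simp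
    qed
  qed
qed

section \<open>Rounding fractional packings\<close>

text \<open>Induction on \<open>k\<close> from a threshold \<open>K\<close>. Dividing the packing on
  the rows by \<open>C * (1 + e) ^ k\<close> makes it fit the integral capacities, and rounding down
  costs at most a factor \<open>1 + e\<close> once \<open>value_bs\<close> is large. If the limit
  capacity is finite, the bound is absorbed into \<open>C\<close>.\<close>

lemma fbs_at_le_value_bs:
  assumes e: "0 < e"
  obtains C K where "0 < C"
    and "\<And>k z. K \<le> k \<Longrightarrow> z \<in> cube (words I k) \<Longrightarrow>
      fbs_at (words I k) (iterate I f k) z \<le> C * (1 + e) ^ k * real (value_bs k (iterate I f k z))"
proof -
  \<comment> \<open>\<open>N\<close> bounds the number of blocks of \<open>f\<close>, hence the
    total rounding loss; values of at least \<open>N / e\<close> make this loss at most a fraction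
    \<open>e\<close>.\<close>
  define N where "N = real (card (Pow I))"
  obtain M :: nat where M: "N / e \<le> real M" using real_arch_simple by blast
  have evM: "eventually (\<lambda>k. value_liminf a = \<infinity> \<longrightarrow> M \<le> value_bs k a) sequentially" for a
    using eventually_value_bs_ge[of M a] by (cases "value_liminf a = \<infinity>") auto
  have "eventually (\<lambda>k. \<forall>a. value_liminf a = \<infinity> \<longrightarrow> M \<le> value_bs k a) sequentially"
    using eventually_conj[OF evM[of True] evM[of False]]
    by (rule eventually_mono) (metis (full_types))
  then obtain K where K: "\<And>k a. K \<le> k \<Longrightarrow> value_liminf a = \<infinity> \<Longrightarrow> M \<le> value_bs k a"
    unfolding eventually_sequentially by blast
  \<comment> \<open>Large enough for the base case \<open>K\<close>, where
    \<open>card (words I K)\<close> is a bound, and for \<open>max 1 (card I)\<close> from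
    \<open>fbs_at_bounded\<close>.\<close>
  define C where "C = 1 + real (card I) + real (card (words I K))"
  have C: "1 \<le> C" "real (card I) \<le> C" "real (card (words I K)) \<le> C" by (auto simp: C_def)
  have grow: "C \<le> C * (1 + e) ^ k" for k
    using C(1) e mult_left_mono[of 1 "(1 + e) ^ k" C] by (simp add: one_le_power)
  have trivial_bound: "t \<le> C * (1 + e) ^ k * real (value_bs k a)" if "t \<le> C" for t k a
  proof -
    have "t \<le> C * (1 + e) ^ k * 1" using that grow[of k] by simp
    also have "\<dots> \<le> C * (1 + e) ^ k * real (value_bs k a)"
      using value_bs_ge_1[of k a] C(1) e by (intro mult_left_mono) auto
    finally show ?thesis .
  qed
  have "fbs_at (words I k) (iterate I f k) z \<le> C * (1 + e) ^ k * real (value_bs k (iterate I f k z))"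
    if "K \<le> k" "z \<in> cube (words I k)" for k z
    using that
  proof (induction k arbitrary: z rule: dec_induct)
    case base
    have "fbs_at (words I K) (iterate I f K) z \<le> C"
      using fbs_at_le_card[OF fin_words base(1), of "iterate I f K"] C(3) by linarith
    then show ?case by (rule trivial_bound)
  next
    case (step k)
    let ?fbs = "fbs_at (words I (Suc k)) (iterate I f (Suc k)) z"
    define x where "x = row_values I f k z"
    define D where "D = C * (1 + e) ^ k"
    have x: "x \<in> cube I" by (simp add: x_def row_values_in_cube)
    have fx: "iterate I f (Suc k) z = f x" by (simp add: x_def iterate_Suc)
    have D: "0 < D" using C(1) e by (simp add: D_def)
    show ?case
    proof (cases "value_liminf (f x) = \<infinity>")
      case False
      have "?fbs \<le> max 1 (real (card I))"
        using fbs_at_bounded[OF False step.prems fx] by (auto split: if_splits)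
      then show ?thesis using C by (intro trivial_bound) auto
    next
      case True
      obtain m where m0: "\<And>A. A \<in> blocks I f x \<Longrightarrow> 0 \<le> m A"
        and m: "\<And>i. i \<in> I \<Longrightarrow> (\<Sum>A\<in>{A \<in> blocks I f x. i \<in> A}. m A)
               \<le> fbs_at (words I k) (iterate I f k) (input_row I k z i)"
        and meq: "?fbs = (\<Sum>A\<in>blocks I f x. m A)"
        using packing_iterate_Suc[OF finite_I step.prems x_def] by metis
      let ?n = "\<lambda>A. nat \<lfloor>m A / D\<rfloor>"
      have n: "real (?n A) \<le> m A / D" "m A / D \<le> real (?n A) + 1" if "A \<in> blocks I f x" for A
        using m0[OF that] D by (simp_all add: of_nat_floor)
      have "(\<Sum>A\<in>blocks I f x. ?n A) \<le> value_bs (Suc k) (f x)"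
      proof (rule value_bs_Suc_ge[OF x])
        fix i assume i: "i \<in> I"
        have xi: "iterate I f k (input_row I k z i) = x i" using i by (simp add: x_def row_values_def)
        have "real (\<Sum>A\<in>{A \<in> blocks I f x. i \<in> A}. ?n A)
            \<le> (\<Sum>A\<in>{A \<in> blocks I f x. i \<in> A}. m A / D)"
          unfolding of_nat_sum by (rule sum_mono) (use n in auto)
        also have "\<dots> = (\<Sum>A\<in>{A \<in> blocks I f x. i \<in> A}. m A) / D"
          by (simp add: sum_divide_distrib)
        \<comment> \<open>By the induction hypothesis row \<open>i\<close> carries at most
          \<open>D * value_bs k (x i)\<close>.\<close>
        also have "\<dots> \<le> real (value_bs k (x i))"
          using m[OF i] step.IH[OF input_row_in_cube[of I k z i]] D
          by (simp add: pos_divide_le_eq xi D_def mult.commute)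
        finally show "(\<Sum>A\<in>{A \<in> blocks I f x. i \<in> A}. ?n A) \<le> value_bs k (x i)"
          by (simp only: of_nat_le_iff)
      qed
      then have sum_n: "(\<Sum>A\<in>blocks I f x. real (?n A)) \<le> real (value_bs (Suc k) (f x))"
        by (simp flip: of_nat_sum)
      have "?fbs / D = (\<Sum>A\<in>blocks I f x. m A / D)"
        by (simp add: meq sum_divide_distrib)
      also have "\<dots> \<le> (\<Sum>A\<in>blocks I f x. real (?n A) + 1)"
        by (rule sum_mono) (rule n(2))
      also have "\<dots> = (\<Sum>A\<in>blocks I f x. real (?n A)) + real (card (blocks I f x))"
        by (simp add: sum.distrib)
      also have "real (card (blocks I f x)) \<le> N"
        unfolding N_def of_nat_le_iff
        by (rule card_mono) (auto simp: finite_I blocks_def)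
      also have "N \<le> e * real (value_bs (Suc k) (f x))"
      proof -
        have "real M \<le> real (value_bs (Suc k) (f x))" using K[OF _ True] step.hyps by simp
        with M have "N / e \<le> real (value_bs (Suc k) (f x))" by linarith
        then show ?thesis using e by (simp add: pos_divide_le_eq mult.commute)
      qed
      also note sum_n
      finally have "?fbs / D \<le> (1 + e) * real (value_bs (Suc k) (f x))"
        by (simp add: algebra_simps)
      then have "?fbs \<le> D * ((1 + e) * real (value_bs (Suc k) (f x)))"
        using D by (simp add: pos_divide_le_eq mult.commute)
      then show ?thesis unfolding fx by (simp add: D_def mult_ac)
    qed
  qed
  with that[of C K] C(1) show ?thesis by auto
qed

lemma fbs_le_bs:
  assumes "0 < e"
  obtains C where "0 < C"
    and "eventually (\<lambda>k. fbs (words I k) (iterate I f k)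
           \<le> C * (1 + e) ^ k * real (bs (words I k) (iterate I f k))) sequentially"
proof -
  obtain C K where C: "0 < C" and K: "\<And>k z. K \<le> k \<Longrightarrow> z \<in> cube (words I k) \<Longrightarrow>
      fbs_at (words I k) (iterate I f k) z \<le> C * (1 + e) ^ k * real (value_bs k (iterate I f k z))"
    using fbs_at_le_value_bs[OF assms] by blast
  have "fbs (words I k) (iterate I f k) \<le> C * (1 + e) ^ k * real (bs (words I k) (iterate I f k))"
    if k: "K \<le> k" for k
  proof -
    obtain z where z: "z \<in> cube (words I k)"
      "fbs (words I k) (iterate I f k) = fbs_at (words I k) (iterate I f k) z"
      using fbs_attained[OF fin_words] by metis
    note z(2)
    also note K[OF k z(1)]
    also have "C * (1 + e) ^ k * real (value_bs k (iterate I f k z))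
        \<le> C * (1 + e) ^ k * real (bs (words I k) (iterate I f k))"
      using C assms value_bs_le_bs by (intro mult_left_mono) auto
    finally show ?thesis .
  qed
  then show ?thesis using that[OF C] by (auto simp: eventually_sequentially)
qed

text \<open>Under the k-th root the factor \<open>C * (1 + e) ^ k\<close> becomes
  \<open>root k C * (1 + e)\<close>, which tends to \<open>1 + e\<close>. It therefore suffices to
  compare the limits up to an arbitrary factor \<open>c < 1\<close>.\<close>

lemma fbs_lim_le_bs_lim: "fbs_lim I f \<le> bs_lim I f"
proof (rule ereal_le_mult_one_interval)
  let ?F = "\<lambda>k. root k (fbs (words I k) (iterate I f k))"
  let ?B = "\<lambda>k. root k (real (bs (words I k) (iterate I f k)))"
  have "0 \<le> bs_lim I f"
    unfolding bs_lim_def by (rule Liminf_bounded) (auto intro!: always_eventually real_root_ge_zero)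
  then show "bs_lim I f \<noteq> -\<infinity>" by auto
  fix c :: ereal assume c: "0 < c" "c < 1"
  then obtain q where q: "c = ereal q" "0 < q" "q < 1" by (cases c) auto
  \<comment> \<open>With this choice \<open>q * (1 + e) = (1 + q) / 2\<close>, which leaves room for
    \<open>root k C\<close>.\<close>
  define e where "e = (1 / q - 1) / 2"
  have e: "0 < e" using q by (simp add: e_def)
  have qe: "q * (1 + e) < 1" using q by (simp add: e_def field_simps)
  obtain C where C: "0 < C" and ev: "eventually (\<lambda>k. fbs (words I k) (iterate I f k)
           \<le> C * (1 + e) ^ k * real (bs (words I k) (iterate I f k))) sequentially"
    using fbs_le_bs[OF e] .
  have "(\<lambda>k. q * (1 + e) * root k C) \<longlonglongrightarrow> q * (1 + e) * 1"
    by (intro tendsto_intros LIMSEQ_root_const C)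
  then have "eventually (\<lambda>k. q * (1 + e) * root k C < 1) sequentially"
    using qe by (intro order_tendstoD(2)) auto
  with ev eventually_gt_at_top[of 0]
  have "eventually (\<lambda>k. ereal q * ereal (?F k) \<le> ereal (?B k)) sequentially"
  proof eventually_elim
    case (elim k)
    have "?F k \<le> root k (C * (1 + e) ^ k * real (bs (words I k) (iterate I f k)))"
      using elim by simp
    also have "\<dots> = root k C * (1 + e) * ?B k"
      using elim e by (simp add: real_root_mult real_root_power_cancel)
    finally have "q * ?F k \<le> q * (root k C * (1 + e) * ?B k)"
      using q by (intro mult_left_mono) auto
    also have "\<dots> = (q * (1 + e) * root k C) * ?B k" by simp
    also have "\<dots> \<le> 1 * ?B k"
      using elim by (intro mult_right_mono) auto
    finally show ?case by simp
  qed
  then have "liminf (\<lambda>k. ereal q * ereal (?F k)) \<le> bs_lim I f"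
    unfolding bs_lim_def by (rule Liminf_mono)
  then show "c * fbs_lim I f \<le> bs_lim I f"
    using q by (simp add: fbs_lim_def Liminf_ereal_mult_left[symmetric])
qed

end

section \<open>The limits\<close>

lemma bs_lim_le_fbs_lim:
  assumes "finite I"
  shows "bs_lim I f \<le> fbs_lim I f"
  unfolding bs_lim_def fbs_lim_def
proof (rule Liminf_mono, rule eventually_mono[OF eventually_gt_at_top[of 0]])
  fix k :: nat assume "0 < k"
  then show "ereal (root k (real (bs (words I k) (iterate I f k))))
      \<le> ereal (root k (fbs (words I k) (iterate I f k)))"
    using bs_le_fbs[OF finite_words[OF assms], of k "iterate I f k"] by simp
qed

text \<open>Stated from \<open>Suc k\<close> on, because the dummy iterate for 0 is not
  constant.\<close>

lemma fbs_iterate_constant: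
  assumes "finite I" and const: "\<And>x. x \<in> cube I \<Longrightarrow> f x = a"
  shows "fbs (words I (Suc k)) (iterate I f (Suc k)) = 0"
proof -
  obtain z where z: "z \<in> cube (words I (Suc k))"
    "fbs (words I (Suc k)) (iterate I f (Suc k)) = fbs_at (words I (Suc k)) (iterate I f (Suc k)) z"
    using fbs_attained[OF finite_words[OF assms(1)]] by metis
  have "blocks (words I (Suc k)) (iterate I f (Suc k)) z = {}"
    by (auto simp: blocks_def iterate_Suc const row_values_in_cube)
  then show ?thesis
    using fbs_at_attained[OF finite_words[OF assms(1)] z(1), of "iterate I f (Suc k)"] z(2) by simp
qed

theorem mainTheorem3:
  fixes I :: "'a set" and f :: "('a \<Rightarrow> bool) \<Rightarrow> bool"
  assumes "finite I"
  shows "bs_lim I f = fbs_lim I f"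
proof (cases "\<forall>a. \<exists>x\<in>cube I. f x = a")
  case True
  then interpret nonconstant_boolean_function I f using assms by unfold_locales auto
  show ?thesis using bs_lim_le_fbs_lim[OF assms] fbs_lim_le_bs_lim by (rule antisym)
next
  case False
  then obtain a where const: "\<And>x. x \<in> cube I \<Longrightarrow> f x = (\<not> a)" by auto
  have zero: "fbs (words I (Suc k)) (iterate I f (Suc k)) = 0" for k
    by (rule fbs_iterate_constant[OF assms const])
  \<comment> \<open>For \<open>k = 0\<close> both sides are 0 because \<open>root 0\<close> is 0;
    for larger \<open>k\<close> both sensitivities vanish.\<close>
  have "root k (real (bs (words I k) (iterate I f k))) = root k (fbs (words I k) (iterate I f k))"
    for k
  proof (cases k)
    case (Suc n)
    then show ?thesis
      using zero[of n] bs_le_fbs[OF finite_words[OF assms], of "Suc n" "iterate I f (Suc n)"] by simp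
  qed simp
  then show ?thesis by (simp add: bs_lim_def fbs_lim_def)
qed

end
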